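(* Let $\mathcal{B}$ be a basis for the vector space of functions $\mathbb{R}^n\to\mathbb{R}$, and let $F$ be a polynomial neural field (PNF) of basis $\mathcal{B}$. Suppose that for all $b_1,b_2\in\mathcal{B}$ one has $b_1(x)b_2(x)=\sum_{i\in I}a_ib_i(x)$ with $|I|<\infty$, for some coefficients $a_i\in\mathbb{R}$ and functions $b_i\in\mathcal{B}$ ($i\in I$). Then the output of $F$ is a finite linear sum of the basis functions from $\mathcal{B}$.
   Context: Let $\mathcal{B}$ be a basis for the vector space of functions $\mathbb{R}^n\to\mathbb{R}$. A polynomial neural field (PNF) of basis $\mathcal{B}$ is a neural network $f=g_L\circ\dots\circ g_1\circ\gamma$, where every $g_i$ is a finite degree multivariate polynomial (in general vector-valued, i.e. a map between finite-dimensional real coordinate spaces each of whose coordinates is a multivariate polynomial of finite degree), and $\gamma:\mathbb{R}^n\to\mathbb{R}^d$ is a $d$-dimensional feature encoding using $\mathcal{B}$: $\gamma(x)=[\gamma_1(x),\dots,\gamma_d(x)]^T$ with $\gamma_i\in\mathcal{B}$ for all $i$. For a vector-valued output, the conclusion is meant for each coordinate of the output. *)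

theory Defs
  imports
    "HOL-Analysis.Finite_Cartesian_Product"
    "HOL-Library.Function_Algebras"
    "HOL-Library.Poly_Mapping"
begin

definition fun_scale :: "real \<Rightarrow> ('a \<Rightarrow> real) \<Rightarrow> 'a \<Rightarrow> real" where
  "fun_scale c f = (\<lambda>x. c * f x)"

interpretation fun_space: vector_space fun_scale
  by unfold_locales (auto simp: fun_scale_def fun_eq_iff algebra_simps)

text \<open>
  Algebraic (Hamel) basis of a vector space \<open>V\<close> of functions; \<open>V = UNIV\<close> is the space of all
  functions. The space is a parameter because for \<open>V = UNIV\<close> every function whatsoever is a finite
  linear sum of basis functions, whereas concrete families (e.g. a Fourier family) span a proper
  subspace. Of the space of all functions, one property is then needed of \<open>V\<close>: it must contain the
  constants, since polynomial layers may have constant terms.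
\<close>

definition basis_of :: "('a \<Rightarrow> real) set \<Rightarrow> ('a \<Rightarrow> real) set \<Rightarrow> bool" where
  "basis_of V B \<longleftrightarrow> fun_space.independent B \<and> fun_space.span B = V"

definition finite_linear_sum :: "('a \<Rightarrow> real) set \<Rightarrow> ('a \<Rightarrow> real) \<Rightarrow> bool" where
  "finite_linear_sum B f \<longleftrightarrow>
     (\<exists>(I :: nat set) a b. finite I \<and> (\<forall>i\<in>I. b i \<in> B) \<and> (\<forall>x. f x = (\<Sum>i\<in>I. a i * b i x)))"

text \<open>
  Layer widths vary inside one network, so a point of \<open>k\<close>-dimensional real space is a function
  \<open>nat \<Rightarrow> real\<close> of which only the coordinates with index below \<open>k\<close> are meaningful.

  A multivariate polynomial is a finitely supported map from monomials to coefficients, a monomial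
  being a finitely supported map from variable indices to exponents.
\<close>

type_synonym mpoly_real = "(nat \<Rightarrow>\<^sub>0 nat) \<Rightarrow>\<^sub>0 real"

definition mpoly_in :: "nat \<Rightarrow> mpoly_real \<Rightarrow> bool" where
  "mpoly_in k p \<longleftrightarrow> (\<forall>m \<in> Poly_Mapping.keys p. Poly_Mapping.keys m \<subseteq> {..<k})"

definition mpoly_eval :: "mpoly_real \<Rightarrow> (nat \<Rightarrow> real) \<Rightarrow> real" where
  "mpoly_eval p v =
     (\<Sum>m \<in> Poly_Mapping.keys p. Poly_Mapping.lookup p m *
        (\<Prod>i \<in> Poly_Mapping.keys m. v i ^ Poly_Mapping.lookup m i))"

definition polynomial_map :: "nat \<Rightarrow> nat \<Rightarrow> ((nat \<Rightarrow> real) \<Rightarrow> nat \<Rightarrow> real) \<Rightarrow> bool" where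
  "polynomial_map k m g \<longleftrightarrow> (\<forall>j<m. \<exists>p. mpoly_in k p \<and> (\<forall>v. g v j = mpoly_eval p v))"

definition feature_encoding :: "('a \<Rightarrow> real) set \<Rightarrow> nat \<Rightarrow> ('a \<Rightarrow> nat \<Rightarrow> real) \<Rightarrow> bool" where
  "feature_encoding B d \<gamma> \<longleftrightarrow> (\<forall>i<d. (\<lambda>x. \<gamma> x i) \<in> B)"

text \<open>
  Here \<open>w 0\<close> is the dimension of the feature encoding, \<open>w i\<close> the output dimension of the layer
  \<open>g i\<close>, and \<open>fold g [1..<Suc L]\<close> is the composition \<open>g L \<circ> \<dots> \<circ> g 1\<close>.
\<close>

definition polynomial_neural_field :: "('a \<Rightarrow> real) set \<Rightarrow> nat \<Rightarrow> ('a \<Rightarrow> nat \<Rightarrow> real) \<Rightarrow> bool" where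
  "polynomial_neural_field B m F \<longleftrightarrow>
     (\<exists>L w g \<gamma>. 1 \<le> L \<and> w L = m \<and> feature_encoding B (w 0) \<gamma> \<and>
        (\<forall>i\<in>{1..L}. polynomial_map (w (i - 1)) (w i) (g i)) \<and>
        F = fold g [1..<Suc L] \<circ> \<gamma>)"

end

theory Submission
  imports Defs
begin

text \<open>
  Finite linear sums of \<open>B\<close> are the elements of the linear span of \<open>B\<close>. By bilinearity, closure of
  the span under products need only be checked on \<open>B\<close>. Hence the span is a subalgebra of the
  functions, containing the constants, and polynomial layers preserve it coordinatewise.
\<close>

lemma sum_function_apply: "(\<Sum>i\<in>I. f i) x = (\<Sum>i\<in>I. f i x)"
  for f :: "'i \<Rightarrow> 'a \<Rightarrow> 'b::comm_monoid_add"
  by (induction I rule: infinite_finite_induct) auto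

text \<open>The sum stands under the binder, as it does in \<open>mpoly_eval\<close> and
  \<open>finite_linear_sum\<close>, so that the rule applies to such terms by
  \<open>intro\<close>.\<close>

lemma span_sumI:
  assumes "\<And>i. i \<in> I \<Longrightarrow> f i \<in> fun_space.span B"
  shows "(\<lambda>x. \<Sum>i\<in>I. f i x) \<in> fun_space.span B"
proof -
  have "(\<Sum>i\<in>I. f i) = (\<lambda>x. \<Sum>i\<in>I. f i x)"
    by (simp add: fun_eq_iff sum_function_apply)
  then show ?thesis
    using fun_space.span_sum[of I f B] assms by simp
qed

lemma span_scaleI: "f \<in> fun_space.span B \<Longrightarrow> (\<lambda>x. c * f x) \<in> fun_space.span B"
  using fun_space.span_scale[of f B c] by (simp add: fun_scale_def)

lemma finite_linear_sum_iff_span: "finite_linear_sum B f \<longleftrightarrow> f \<in> fun_space.span B"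
proof
  assume "finite_linear_sum B f"
  then obtain I :: "nat set" and a b where
    b: "\<forall>i\<in>I. b i \<in> B" and f: "\<forall>x. f x = (\<Sum>i\<in>I. a i * b i x)"
    unfolding finite_linear_sum_def by blast
  have "(\<lambda>x. \<Sum>i\<in>I. a i * b i x) \<in> fun_space.span B"
    using b by (intro span_sumI span_scaleI fun_space.span_base) auto
  then show "f \<in> fun_space.span B"
    by (simp only: f[rule_format, symmetric])
next
  assume "f \<in> fun_space.span B"
  then obtain t r where t: "finite t" "t \<subseteq> B" and f: "f = (\<Sum>h\<in>t. fun_scale (r h) h)"
    unfolding fun_space.span_explicit by blast
  \<comment> \<open>\<open>span_explicit\<close> indexes the sum by the vectors themselves,
    \<open>finite_linear_sum\<close> by naturals. Enumerating \<open>t\<close> bridges this: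
    \<open>e\<close> is the family of basis functions and \<open>r (e i)\<close> its
    coefficients.\<close>
  obtain e where e: "bij_betw e {0..<card t} t"
    using ex_bij_betw_nat_finite[OF \<open>finite t\<close>] by blast
  have "f x = (\<Sum>i\<in>{0..<card t}. r (e i) * e i x)" for x
    unfolding f using sum.reindex_bij_betw[OF e, of "\<lambda>h. r h * h x"]
    by (simp add: sum_function_apply fun_scale_def)
  moreover have "\<forall>i\<in>{0..<card t}. e i \<in> B"
    using e t bij_betwE by blast
  ultimately show "finite_linear_sum B f"
    unfolding finite_linear_sum_def
    by (intro exI[of _ "{0..<card t}"] exI[of _ "\<lambda>i. r (e i)"] exI[of _ e]) auto
qed

context
  fixes B :: "('a \<Rightarrow> real) set"
  assumes one: "(\<lambda>_. 1) \<in> fun_space.span B"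
    and mult: "\<And>b1 b2. b1 \<in> B \<Longrightarrow> b2 \<in> B \<Longrightarrow> (\<lambda>x. b1 x * b2 x) \<in> fun_space.span B"
begin

text \<open>Two nested span inductions, one per factor; pointwise multiplication is linear in
  each.\<close>

lemma span_multI:
  assumes f: "f \<in> fun_space.span B" and h: "h \<in> fun_space.span B"
  shows "(\<lambda>x. f x * h x) \<in> fun_space.span B"
proof -
  \<comment> \<open>The left factor stays in \<open>B\<close> while the right one runs through the
    span; only here is \<open>mult\<close> used.\<close>
  have base: "(\<lambda>x. b x * k x) \<in> fun_space.span B" if b: "b \<in> B" and k: "k \<in> fun_space.span B" for b k
    using k
  proof (induction rule: fun_space.span_induct_alt)
    case base
    show ?case using fun_space.span_zero by (simp add: zero_fun_def)
  next
    case (step c u v)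
    have "(\<lambda>x. b x * (fun_scale c u + v) x) = fun_scale c (\<lambda>x. b x * u x) + (\<lambda>x. b x * v x)"
      by (simp add: fun_eq_iff fun_scale_def algebra_simps)
    with step mult[OF b] show ?case
      by (simp add: fun_space.span_add fun_space.span_scale)
  qed
  show ?thesis
    using f
  proof (induction rule: fun_space.span_induct_alt)
    case base
    show ?case using fun_space.span_zero by (simp add: zero_fun_def)
  next
    case (step c u v)
    have "(\<lambda>x. (fun_scale c u + v) x * h x) = fun_scale c (\<lambda>x. u x * h x) + (\<lambda>x. v x * h x)"
      by (simp add: fun_eq_iff fun_scale_def algebra_simps)
    with step base[OF _ h] show ?case
      by (simp add: fun_space.span_add fun_space.span_scale)
  qed
qed

lemma span_powerI: "f \<in> fun_space.span B \<Longrightarrow> (\<lambda>x. f x ^ n) \<in> fun_space.span B"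
  by (induction n) (simp_all add: one span_multI)

text \<open>The empty product is the constant 1, covered by \<open>one\<close>; this is how constant
  terms of polynomials enter. An infinite product is 1 by convention.\<close>

lemma span_prodI:
  assumes "\<And>i. i \<in> I \<Longrightarrow> f i \<in> fun_space.span B"
  shows "(\<lambda>x. \<Prod>i\<in>I. f i x) \<in> fun_space.span B"
  using assms by (induction I rule: infinite_finite_induct) (simp_all add: one span_multI)

text \<open>By \<open>mpoly_in\<close>, the evaluation reads only coordinates below
  \<open>k\<close>, so nothing is asked of the others. Here \<open>u\<close> stands for the earlier
  layers as a function of the network input.\<close>

lemma span_mpoly_evalI:
  assumes "mpoly_in k p" and "\<And>i. i < k \<Longrightarrow> (\<lambda>x. u x i) \<in> fun_space.span B"
  shows "(\<lambda>x. mpoly_eval p (u x)) \<in> fun_space.span B"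
  unfolding mpoly_eval_def
  using assms
  by (intro span_sumI span_scaleI span_prodI span_powerI) (auto simp: mpoly_in_def)

lemma span_polynomial_mapI:
  assumes "polynomial_map k m g" and "\<And>i. i < k \<Longrightarrow> (\<lambda>x. u x i) \<in> fun_space.span B" and "j < m"
  shows "(\<lambda>x. g (u x) j) \<in> fun_space.span B"
proof -
  obtain p where "mpoly_in k p" "\<forall>v. g v j = mpoly_eval p v"
    using assms unfolding polynomial_map_def by blast
  then show ?thesis
    using span_mpoly_evalI assms(2) by simp
qed

lemma span_polynomial_neural_fieldI:
  assumes "polynomial_neural_field B m F" and "j < m"
  shows "(\<lambda>x. F x j) \<in> fun_space.span B"
proof -
  obtain L w g \<gamma> where w: "w L = m" and \<gamma>: "feature_encoding B (w 0) \<gamma>"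
    and g: "\<forall>i\<in>{1..L}. polynomial_map (w (i - 1)) (w i) (g i)"
    and F: "F = fold g [1..<Suc L] \<circ> \<gamma>"
    using assms(1) unfolding polynomial_neural_field_def by blast
  \<comment> \<open>Induction on the number of layers applied; for \<open>l = 0\<close> the list is
    empty and only the encoding remains. The coordinate \<open>i\<close> is arbitrary because a
    layer may read every coordinate of the previous one.\<close>
  have "(\<lambda>x. fold g [1..<Suc l] (\<gamma> x) i) \<in> fun_space.span B" if "l \<le> L" "i < w l" for l i
    using that
  proof (induction l arbitrary: i)
    case 0
    then show ?case
      using \<gamma> by (simp add: feature_encoding_def fun_space.span_base)
  next
    case (Suc l)
    have "polynomial_map (w l) (w (Suc l)) (g (Suc l))"
      using g Suc.prems by force
    then have "(\<lambda>x. g (Suc l) (fold g [1..<Suc l] (\<gamma> x)) i) \<in> fun_space.span B"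
      by (rule span_polynomial_mapI) (use Suc in simp_all)
    \<comment> \<open>\<open>Suc l\<close> is the last entry of \<open>[1..<Suc (Suc l)]\<close>, so
      \<open>fold\<close> applies \<open>g (Suc l)\<close> outermost.\<close>
    then show ?case by simp
  qed
  then show ?thesis
    using F w \<open>j < m\<close> by simp
qed

end

theorem theorem1:
  fixes V B :: "(real ^ 'n \<Rightarrow> real) set"
    and F :: "real ^ 'n \<Rightarrow> nat \<Rightarrow> real"
    and m :: nat
  assumes basis: "basis_of V B"
    and const: "(\<lambda>_. 1) \<in> V"
    and pnf: "polynomial_neural_field B m F"
    and prod: "\<forall>b1\<in>B. \<forall>b2\<in>B. finite_linear_sum B (\<lambda>x. b1 x * b2 x)"
  shows "\<forall>j<m. finite_linear_sum B (\<lambda>x. F x j)"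
  \<comment> \<open>Since \<open>V\<close> is the span of \<open>B\<close>, \<open>const\<close>
    becomes the assumption \<open>one\<close>, and \<open>prod\<close> becomes \<open>mult\<close>
    by \<open>finite_linear_sum_iff_span\<close>.\<close>
  using basis const prod span_polynomial_neural_fieldI[OF _ _ pnf]
  by (simp add: basis_of_def finite_linear_sum_iff_span)

end
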